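(* Every space in the class $KL\Sigma(<\omega)$ contains a dense metrizable subspace.
   Context: All spaces are Tychonoff. A multivalued mapping $p\colon M\to X$ assigns to each $m\in M$ a (possibly empty) subset $p(m)\subseteq X$; it is upper semicontinuous (usc) if $\{m\in M: p(m)\subseteq V\}$ is open in $M$ for each open $V\subseteq X$; $p(M)=\bigcup_{m\in M}p(m)$. A space $X$ is in $KL\Sigma(<\omega)$ if there are a compact second-countable space $M$ and a usc mapping $p\colon M\to X$ such that $p(M)=X$ and $p(m)$ is finite for every $m\in M$. (All such $X$ are compact.) *)

theory Defs
  imports "HOL-Analysis.Analysis"
begin

text \<open>The library's \<^const>\<open>completely_regular_space\<close> carries no separation axiom for points,
  whereas Tychonoff spaces are understood to be Hausdorff.\<close>

definition tychonoff_space :: "'a topology \<Rightarrow> bool" where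
  "tychonoff_space X \<longleftrightarrow> completely_regular_space X \<and> Hausdorff_space X"

text \<open>Only the values on \<^term>\<open>topspace M\<close> matter; empty values are allowed.\<close>

definition multivalued_map :: "'b topology \<Rightarrow> 'a topology \<Rightarrow> ('b \<Rightarrow> 'a set) \<Rightarrow> bool" where
  "multivalued_map M X p \<longleftrightarrow> (\<forall>m \<in> topspace M. p m \<subseteq> topspace X)"

definition usc_map :: "'b topology \<Rightarrow> 'a topology \<Rightarrow> ('b \<Rightarrow> 'a set) \<Rightarrow> bool" where
  "usc_map M X p \<longleftrightarrow>
     multivalued_map M X p \<and>
     (\<forall>V. openin X V \<longrightarrow> openin M {m \<in> topspace M. p m \<subseteq> V})"

text \<open>A definition in HOL cannot quantify over the type of the points of \<^term>\<open>M\<close>, so that type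
  is passed as a parameter. A theorem assuming \<open>KL_Sigma_fin TYPE('b) X\<close> with \<open>'b\<close> a type
  variable covers compact second-countable spaces \<^term>\<open>M\<close> over every type.\<close>

definition KL_Sigma_fin :: "'b itself \<Rightarrow> 'a topology \<Rightarrow> bool" where
  "KL_Sigma_fin (_ :: 'b itself) X \<longleftrightarrow>
     tychonoff_space X \<and>
     (\<exists>(M :: 'b topology) p.
        tychonoff_space M \<and> compact_space M \<and> second_countable M \<and>
        usc_map M X p \<and>
        (\<Union>m \<in> topspace M. p m) = topspace X \<and>
        (\<forall>m \<in> topspace M. finite (p m)))"

end

theory Submission
  imports Defs
begin

text \<open>Write \<open>p(E)\<close> for the union of the values of \<open>p\<close> on \<open>E\<close>. Two facts drive the proof.

  First, the points of countable character are dense: inside a given open set one chooses open sets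
  \<open>U\<^sub>n\<close> with \<open>cl U\<^sub>n\<^sub>+\<^sub>1 \<subseteq> U\<^sub>n\<close> and closed sets \<open>E\<^sub>n\<close> in \<open>M\<close>, decreasing to at most one point, with
  \<open>U\<^sub>n \<subseteq> p(E\<^sub>n)\<close>. Then the intersection of the \<open>U\<^sub>n\<close> lies in a single finite value of \<open>p\<close>, so its
  points are \<open>G\<^sub>\<delta>\<close> points of a compact space.

  Second, every nonempty open set contains a nonempty open set \<open>V\<close> with a countable dense set of such
  points. Otherwise one finds decreasing open \<open>U\<^sub>n\<close> and countable \<open>S\<^sub>n \<subseteq> U\<^sub>n\<close> such that the closures of
  the \<open>S\<^sub>n\<close> are pairwise disjoint although \<open>p(m)\<close> meets all of them for one \<open>m\<close>, and \<open>p(m)\<close> would be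
  infinite.

  The union of these countable sets over a maximal disjoint family of such \<open>V\<close> is a topological sum of
  second countable spaces.\<close>

section \<open>Metrization\<close>

text \<open>Condition \<open>sep\<close> makes \<open>h\<close> open onto its image: every image
  point of an open set \<open>U\<close> has a trace of some open \<open>W\<close> around it that
  stays inside the image of \<open>U\<close>.\<close>

lemma embedding_map_if_separating:
  assumes "continuous_map X Y h" "inj_on h (topspace X)"
    and sep: "\<And>U x. openin X U \<Longrightarrow> x \<in> U \<Longrightarrow>
               \<exists>W. openin Y W \<and> h x \<in> W \<and> {y \<in> topspace X. h y \<in> W} \<subseteq> U"
  shows "embedding_map X Y h"
proof -
  let ?Z = "subtopology Y (h ` topspace X)"
  have "open_map X ?Z h"
    unfolding open_map_def
  proof (intro allI impI)
    fix U assume U: "openin X U"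
    show "openin ?Z (h ` U)"
    proof (subst openin_subopen, intro ballI)
      fix z assume "z \<in> h ` U"
      then obtain x where x: "x \<in> U" "z = h x" by blast
      obtain W where W: "openin Y W" "h x \<in> W" "{y \<in> topspace X. h y \<in> W} \<subseteq> U"
        using sep[OF U x(1)] by blast
      have "openin ?Z (h ` topspace X \<inter> W)"
        using W(1) by (rule openin_subtopology_Int2)
      moreover have "z \<in> h ` topspace X \<inter> W"
        using x W(2) openin_subset[OF U] by blast
      moreover have "h ` topspace X \<inter> W \<subseteq> h ` U"
        using W(3) by blast
      ultimately show "\<exists>T. openin ?Z T \<and> z \<in> T \<and> T \<subseteq> h ` U" by blast
    qed
  qed
  moreover have "continuous_map X ?Z h"
    using assms(1) by (simp add: continuous_map_in_subtopology)
  ultimately have "embedding_map X ?Z h"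
    using assms(2) by (simp add: injective_open_imp_embedding_map)
  then show ?thesis
    by (simp add: embedding_map_in_subtopology)
qed

text \<open>Urysohn's argument: one real function for each separable pair of basic sets gives
  countably many functions. Together they embed \<open>X\<close> into a countable power of the real
  line, which is metrizable.\<close>

lemma completely_regular_second_countable_imp_metrizable_space:
  assumes X: "completely_regular_space X" "Hausdorff_space X" and "second_countable X"
  shows "metrizable_space X"
proof -
  obtain \<B> where \<B>: "countable \<B>" "\<And>V. V \<in> \<B> \<Longrightarrow> openin X V"
      "\<And>U x. openin X U \<Longrightarrow> x \<in> U \<Longrightarrow> \<exists>V \<in> \<B>. x \<in> V \<and> V \<subseteq> U"
    using assms(3) unfolding second_countable_def by metis
  \<comment> \<open>The bound \<open>1/2\<close> on the open set \<open>A\<close> replaces a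
    prescribed value at a point, so that functions can be indexed by pairs of basic sets instead of
    by points.\<close>
  define sep where "sep A B f \<longleftrightarrow> continuous_map X euclideanreal f \<and>
      (\<forall>x\<in>A. f x < 1/2) \<and> (\<forall>x \<in> topspace X - B. f x = 1)" for A B :: "'a set" and f
  define I where "I = {(A,B). A \<in> \<B> \<and> B \<in> \<B> \<and> (\<exists>f. sep A B f)}"
  have "countable I"
    by (rule countable_subset[of _ "\<B> \<times> \<B>"]) (use \<B>(1) in \<open>auto simp: I_def\<close>)
  define F where "F = (\<lambda>(A,B). SOME f. sep A B f)"
  have F: "sep A B (F (A,B))" if "(A,B) \<in> I" for A B
    using that someI_ex[of "sep A B"] by (auto simp: I_def F_def)
  have Fcont: "continuous_map X euclideanreal (F i)" if "i \<in> I" for i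
    using F that by (cases i) (auto simp: sep_def)
  have ex: "\<exists>A B. (A,B) \<in> I \<and> x \<in> A \<and> B \<subseteq> U" if U: "openin X U" "x \<in> U" for U x
  proof -
    obtain B where B: "B \<in> \<B>" "x \<in> B" "B \<subseteq> U" using \<B>(3)[OF U] by blast
    have oB: "openin X B" using \<B>(2) B(1) by blast
    have "closedin X (topspace X - B)" "x \<in> topspace X - (topspace X - B)"
      using oB B(2) openin_subset by auto
    then obtain f :: "'a \<Rightarrow> real" where f: "continuous_map X (top_of_set {0..1}) f" "f x = 0"
        "f ` (topspace X - B) \<subseteq> {1}"
      using X(1) unfolding completely_regular_space_def by blast
    have fc: "continuous_map X euclideanreal f"
      using f(1) by (simp add: continuous_map_in_subtopology)
    have "openin X {y \<in> topspace X. f y \<in> {..<1/2}}"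
      by (rule openin_continuous_map_preimage[OF fc]) auto
    moreover have "x \<in> {y \<in> topspace X. f y \<in> {..<1/2}}"
      using f(2) oB B(2) openin_subset by auto
    ultimately obtain A where A: "A \<in> \<B>" "x \<in> A" "A \<subseteq> {y \<in> topspace X. f y \<in> {..<1/2}}"
      using \<B>(3) by blast
    have "sep A B f" using fc A(3) f(3) by (auto simp: sep_def)
    then show ?thesis using A B by (auto simp: I_def)
  qed
  define h where "h x = (\<lambda>i\<in>I. F i x)" for x
  let ?Y = "product_topology (\<lambda>i. euclideanreal) I"
  have sep: "\<exists>W. openin ?Y W \<and> h x \<in> W \<and> {y \<in> topspace X. h y \<in> W} \<subseteq> U"
    if U: "openin X U" "x \<in> U" for U x
  proof -
    obtain A B where AB: "(A,B) \<in> I" "x \<in> A" "B \<subseteq> U" using ex[OF U] by blast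
    \<comment> \<open>Coordinate \<open>(A,B)\<close> is below \<open>1/2\<close> on
      \<open>A\<close> and equals 1 off \<open>B\<close>, so this open cylinder contains
      \<open>h x\<close> and pulls back into \<open>B\<close>.\<close>
    let ?W = "{z \<in> topspace ?Y. z (A,B) \<in> {..<1/2}}"
    have "openin ?Y ?W"
      by (rule openin_continuous_map_preimage[OF continuous_map_product_projection[OF AB(1)]]) auto
    moreover have "h x \<in> ?W"
      using F[OF AB(1)] AB by (auto simp: h_def sep_def)
    moreover have "y \<in> U" if "y \<in> topspace X" "h y \<in> ?W" for y
    proof (rule ccontr)
      assume "y \<notin> U"
      then have "F (A,B) y = 1" using F[OF AB(1)] AB(3) that(1) by (auto simp: sep_def)
      then show False using that(2) AB(1) by (simp add: h_def)
    qed
    ultimately show ?thesis by blast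
  qed
  have "continuous_map X ?Y h"
    using Fcont by (auto simp: h_def continuous_map_componentwise cong: restrict_cong)
  moreover have "inj_on h (topspace X)"
  proof (rule inj_onI, rule ccontr)
    fix x y assume xy: "x \<in> topspace X" "y \<in> topspace X" "h x = h y" "x \<noteq> y"
    have "openin X (topspace X - {y})"
      using X(2) xy(2) by (simp add: closedin_Hausdorff_singleton openin_diff)
    then obtain W where "h x \<in> W" "{z \<in> topspace X. h z \<in> W} \<subseteq> topspace X - {y}"
      using sep[of "topspace X - {y}" x] xy by blast
    then show False using xy by auto
  qed
  ultimately have "embedding_map X ?Y h"
    using sep by (rule embedding_map_if_separating)
  then have "X homeomorphic_space subtopology ?Y (h ` topspace X)"
    by (rule embedding_map_imp_homeomorphic_space)
  moreover have "metrizable_space ?Y"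
    using \<open>countable I\<close>
    by (simp add: metrizable_space_product_topology metrizable_space_euclidean)
  ultimately show ?thesis
    using homeomorphic_metrizable_space metrizable_space_subtopology by blast
qed

text \<open>Metrics of the pieces are truncated at 1, which does not change small balls, and points
  of different pieces get distance 1.\<close>

lemma metrizable_space_disjoint_open_cover:
  assumes disj: "pairwise disjnt \<V>" and cover: "\<Union>\<V> = topspace X"
    and op: "\<And>V. V \<in> \<V> \<Longrightarrow> openin X V"
    and metr: "\<And>V. V \<in> \<V> \<Longrightarrow> metrizable_space (subtopology X V)"
  shows "metrizable_space X"
proof -
  have "\<exists>d. Metric_space V d \<and> subtopology X V = Metric_space.mtopology V d" if V: "V \<in> \<V>" for V
  proof -
    obtain A d where A: "Metric_space A d" "subtopology X V = Metric_space.mtopology A d"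
      using metr[OF V] unfolding metrizable_space_def by blast
    have "A = topspace (subtopology X V)"
      using A by (simp add: Metric_space.topspace_mtopology)
    also have "\<dots> = V" using openin_subset[OF op[OF V]] by auto
    finally show ?thesis using A by blast
  qed
  then obtain d where d: "\<And>V. V \<in> \<V> \<Longrightarrow> Metric_space V (d V)"
      "\<And>V. V \<in> \<V> \<Longrightarrow> subtopology X V = Metric_space.mtopology V (d V)"
    by metis
  define c where "c x = (SOME V. V \<in> \<V> \<and> x \<in> V)" for x
  have c: "c x \<in> \<V>" "x \<in> c x" if "x \<in> topspace X" for x
    using someI_ex[of "\<lambda>V. V \<in> \<V> \<and> x \<in> V"] that cover unfolding c_def by auto
  have c_eq: "c x = V" if "x \<in> V" "V \<in> \<V>" for x V
    using c[of x] that cover disj unfolding pairwise_def disjnt_def by blast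
  \<comment> \<open>\<open>Metric_space\<close> demands nonnegativity and symmetry for all
    arguments. The test \<open>c x \<in> \<V>\<close> takes care of points outside the space, where
    the choice \<open>c x\<close> is arbitrary.\<close>
  define e where "e x y = (if c x = c y \<and> c x \<in> \<V> then min 1 (d (c x) x y) else 1)" for x y
  interpret e: Metric_space "topspace X" e
  proof
    fix x y
    show "0 \<le> e x y"
      using Metric_space.nonneg[OF d(1), of "c x" x y] by (auto simp: e_def)
    show "e x y = e y x"
      using Metric_space.commute[OF d(1), of "c x" x y] by (auto simp: e_def)
    assume x: "x \<in> topspace X" and y: "y \<in> topspace X"
    show "e x y = 0 \<longleftrightarrow> x = y"
    proof (cases "c x = c y")
      case True
      then show ?thesis
        using Metric_space.zero[OF d(1)[OF c(1)[OF x]], of x y] c[OF x] c(2)[OF y]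
        by (auto simp: e_def min_def)
    qed (auto simp: e_def)
    fix z assume z: "z \<in> topspace X"
    show "e x z \<le> e x y + e y z"
    proof (cases "c x = c y \<and> c y = c z")
      case True
      then have "d (c x) x z \<le> d (c x) x y + d (c x) y z"
        using Metric_space.triangle[OF d(1)[OF c(1)[OF x]], of x y z] c(2)[OF x] c(2)[OF y] c(2)[OF z]
        by simp
      moreover have "0 \<le> d (c x) x y" "0 \<le> d (c x) y z"
        using Metric_space.nonneg[OF d(1)[OF c(1)[OF x]]] by auto
      ultimately show ?thesis
        using True c(1)[OF x] by (auto simp: e_def min_def)
    next
      case False
      \<comment> \<open>If the three points do not share a piece, one summand on the right is
        already 1, the largest value of \<open>e\<close>.\<close>
      have "0 \<le> e u v" "e u v \<le> 1" for u v
        using Metric_space.nonneg[OF d(1), of "c u" u v] by (auto simp: e_def)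
      moreover have "e x y = 1 \<or> e y z = 1"
        using False by (auto simp: e_def)
      ultimately show ?thesis by (smt (verit))
    qed
  qed
  have "e.mtopology = X"
    unfolding topology_eq
  proof (intro allI iffI)
    fix U assume U: "openin e.mtopology U"
    show "openin X U"
    proof (subst openin_subopen, intro ballI)
      fix x assume "x \<in> U"
      then obtain r where r: "r > 0" "e.mball x r \<subseteq> U" and x: "x \<in> topspace X"
        using U unfolding e.openin_mtopology by blast
      interpret V: Metric_space "c x" "d (c x)" using d(1) c(1)[OF x] .
      have "openin (subtopology X (c x)) (V.mball x r)"
        using d(2)[OF c(1)[OF x]] by simp
      then have "openin X (V.mball x r)"
        using op[OF c(1)[OF x]] openin_open_subtopology by blast
      moreover have "x \<in> V.mball x r" using c(2)[OF x] r(1) by simp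
      moreover have "y \<in> e.mball x r" if y: "y \<in> V.mball x r" for y
      proof -
        have yV: "y \<in> c x" "d (c x) x y < r" using y by auto
        have "c y = c x" using yV(1) c(1)[OF x] by (rule c_eq)
        then have "e x y < r" using yV(2) c(1)[OF x] by (simp add: e_def)
        moreover have "y \<in> topspace X" using yV(1) c(1)[OF x] cover by blast
        ultimately show ?thesis using x by simp
      qed
      ultimately show "\<exists>T. openin X T \<and> x \<in> T \<and> T \<subseteq> U" using r(2) by blast
    qed
  next
    fix U assume U: "openin X U"
    have "\<exists>r>0. e.mball x r \<subseteq> U" if "x \<in> U" for x
    proof -
      have x: "x \<in> topspace X" using U that openin_subset by blast
      interpret V: Metric_space "c x" "d (c x)" using d(1) c(1)[OF x] .
      have "openin V.mtopology (c x \<inter> U)"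
        using d(2)[OF c(1)[OF x]] openin_subtopology_Int2[OF U, of "c x"] by simp
      moreover have "x \<in> c x \<inter> U" using c(2)[OF x] that by blast
      ultimately obtain r where r: "r > 0" "V.mball x r \<subseteq> c x \<inter> U"
        unfolding V.openin_mtopology by blast
      \<comment> \<open>Radius at most 1 keeps the ball inside the piece of \<open>x\<close>, where
        \<open>e\<close> below 1 agrees with \<open>d (c x)\<close>.\<close>
      have "y \<in> U" if y: "y \<in> e.mball x (min r 1)" for y
      proof -
        have "y \<in> topspace X" "e x y < r" "e x y < 1" using y by auto
        then have "y \<in> c x" "d (c x) x y < r"
          using c(2)[of y] by (auto simp: e_def split: if_splits)
        then have "y \<in> V.mball x r" using c(2)[OF x] by simp
        then show ?thesis using r(2) by blast
      qed
      then show ?thesis using r(1) by (intro exI[of _ "min r 1"]) auto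
    qed
    then show "openin e.mtopology U"
      using openin_subset[OF U] by (simp add: e.openin_mtopology)
  qed
  then show ?thesis using e.metrizable_space_mtopology by simp
qed

section \<open>Points of countable character\<close>

definition countable_base_at :: "'a topology \<Rightarrow> 'a \<Rightarrow> bool" where
  "countable_base_at X x \<longleftrightarrow>
     (\<exists>\<B>. countable \<B> \<and> (\<forall>V \<in> \<B>. openin X V) \<and>
          (\<forall>U. openin X U \<and> x \<in> U \<longrightarrow> (\<exists>V \<in> \<B>. x \<in> V \<and> V \<subseteq> U)))"

text \<open>Countable local bases at the points of \<open>S\<close>, cut down to \<open>S\<close>,
  together form a base of the subspace.\<close>

lemma second_countable_subtopology_countable:
  assumes "countable S" and S: "\<And>x. x \<in> S \<Longrightarrow> countable_base_at X x"
  shows "second_countable (subtopology X S)"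
proof -
  obtain \<B> where \<B>: "\<And>x. x \<in> S \<Longrightarrow> countable (\<B> x)"
      "\<And>x V. x \<in> S \<Longrightarrow> V \<in> \<B> x \<Longrightarrow> openin X V"
      "\<And>x U. x \<in> S \<Longrightarrow> openin X U \<Longrightarrow> x \<in> U \<Longrightarrow> \<exists>V \<in> \<B> x. x \<in> V \<and> V \<subseteq> U"
    using S unfolding countable_base_at_def by metis
  let ?\<C> = "(\<lambda>V. V \<inter> S) ` (\<Union>x\<in>S. \<B> x)"
  have "countable ?\<C>" using assms(1) \<B>(1) by blast
  moreover have "openin (subtopology X S) W" if "W \<in> ?\<C>" for W
    using that \<B>(2) by (auto simp: openin_subtopology)
  moreover have "\<exists>W \<in> ?\<C>. x \<in> W \<and> W \<subseteq> U" if "openin (subtopology X S) U" "x \<in> U" for U x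
  proof -
    obtain T where T: "openin X T" "U = T \<inter> S"
      using \<open>openin (subtopology X S) U\<close> by (auto simp: openin_subtopology)
    have x: "x \<in> S" "x \<in> T" using T(2) \<open>x \<in> U\<close> by auto
    obtain V where V: "V \<in> \<B> x" "x \<in> V" "V \<subseteq> T" using \<B>(3)[OF x(1) T(1) x(2)] by blast
    show ?thesis
      by (rule bexI[of _ "V \<inter> S"]) (use V x T in auto)
  qed
  ultimately show ?thesis
    unfolding second_countable_def by (intro exI[of _ ?\<C>]) simp
qed

text \<open>Zorn's lemma gives a maximal disjoint family of open sets \<open>V\<close> with
  countable dense sets \<open>S V\<close> of points of countable character. Maximality makes the
  union \<open>D\<close> of these countable sets dense. Disjointness makes \<open>D\<close> the
  topological sum of the \<open>S V\<close>, each of which is second countable.\<close>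

lemma dense_metrizable_subspace:
  assumes X: "completely_regular_space X" "Hausdorff_space X"
    and ex: "\<And>U. openin X U \<Longrightarrow> U \<noteq> {} \<Longrightarrow>
           \<exists>V S. openin X V \<and> V \<noteq> {} \<and> V \<subseteq> U \<and> countable S \<and> S \<subseteq> V \<and>
                 (\<forall>x\<in>S. countable_base_at X x) \<and> V \<subseteq> X closure_of S"
  shows "\<exists>D. D \<subseteq> topspace X \<and> X closure_of D = topspace X \<and>
             metrizable_space (subtopology X D)"
proof -
  define good where "good V S \<longleftrightarrow> openin X V \<and> V \<noteq> {} \<and> countable S \<and> S \<subseteq> V \<and>
                 (\<forall>x\<in>S. countable_base_at X x) \<and> V \<subseteq> X closure_of S" for V S
  define \<A> where "\<A> = {\<V>. pairwise disjnt \<V> \<and> (\<forall>V\<in>\<V>. \<exists>S. good V S)}"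
  have "\<Union>C \<in> \<A>" if "subset.chain \<A> C" for C
  proof -
    have "C \<subseteq> \<A>" and lin: "\<And>A B. A \<in> C \<Longrightarrow> B \<in> C \<Longrightarrow> A \<subseteq> B \<or> B \<subseteq> A"
      using that by (auto simp: subset_chain_def)
    moreover have "pairwise disjnt (\<Union>C)"
    proof (rule pairwiseI)
      fix V W assume "V \<in> \<Union>C" "W \<in> \<Union>C" "V \<noteq> W"
      then obtain A where "A \<in> C" "V \<in> A" "W \<in> A" using lin by blast
      then show "disjnt V W"
        using \<open>C \<subseteq> \<A>\<close> \<open>V \<noteq> W\<close> by (auto simp: \<A>_def pairwise_def)
    qed
    ultimately show ?thesis by (auto simp: \<A>_def)
  qed
  then obtain \<V> where \<V>: "\<V> \<in> \<A>" and max: "\<And>\<W>. \<W> \<in> \<A> \<Longrightarrow> \<V> \<subseteq> \<W> \<Longrightarrow> \<W> = \<V>"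
    using subset_Zorn'[of \<A>] by blast
  have disj: "V \<inter> W = {}" if "V \<in> \<V>" "W \<in> \<V>" "V \<noteq> W" for V W
    using \<V> that by (auto simp: \<A>_def pairwise_def disjnt_def)
  have "\<forall>V\<in>\<V>. \<exists>S. good V S"
    using \<V> by (simp add: \<A>_def)
  then obtain S where S: "\<And>V. V \<in> \<V> \<Longrightarrow> good V (S V)"
    by metis
  define D where "D = (\<Union>V\<in>\<V>. S V)"
  have D: "D \<subseteq> topspace X"
    using S openin_subset unfolding D_def good_def by blast
  have "D \<inter> T \<noteq> {}" if T: "openin X T" "T \<noteq> {}" for T
  proof -
    \<comment> \<open>If \<open>T\<close> missed the whole family, a good subset of \<open>T\<close>
      could be added to it, against maximality.\<close>
    have "\<exists>V\<in>\<V>. T \<inter> V \<noteq> {}"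
    proof (rule ccontr)
      assume no: "\<not> ?thesis"
      obtain V S' where V: "good V S'" "V \<subseteq> T"
        using ex[OF T] unfolding good_def by blast
      have "insert V \<V> \<in> \<A>"
        using \<V> V no by (auto simp: \<A>_def pairwise_insert disjnt_def)
      then have "V \<in> \<V>" using max by blast
      then show False using no V unfolding good_def by blast
    qed
    then obtain V x where "V \<in> \<V>" "x \<in> T" "x \<in> V" by blast
    moreover from this have "x \<in> X closure_of S V" using S unfolding good_def by blast
    ultimately obtain y where "y \<in> S V" "y \<in> T"
      using T(1) unfolding in_closure_of by blast
    then show ?thesis using \<open>V \<in> \<V>\<close> by (auto simp: D_def)
  qed
  then have "X closure_of D = topspace X"
    by (auto simp: dense_intersects_open)
  moreover have "metrizable_space (subtopology X D)"
  proof (rule metrizable_space_disjoint_open_cover[of "S ` \<V>"])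
    have SV: "S V \<subseteq> V" "openin X V" if "V \<in> \<V>" for V
      using S[OF that] by (auto simp: good_def)
    show "pairwise disjnt (S ` \<V>)"
      using disj SV(1) unfolding pairwise_def disjnt_def by blast
    show "\<Union>(S ` \<V>) = topspace (subtopology X D)"
      using D by (auto simp: D_def)
    fix W assume "W \<in> S ` \<V>"
    then obtain V where V: "V \<in> \<V>" "W = S V" by blast
    \<comment> \<open>Since distinct members of the family are disjoint, \<open>V\<close> meets
      \<open>D\<close> only in its own piece, which is therefore open in \<open>D\<close>.\<close>
    have "S V = D \<inter> V"
      using V(1) SV(1) disj unfolding D_def by blast
    then show "openin (subtopology X D) W"
      using V SV(2) openin_subtopology_Int2 by metis
    have "second_countable (subtopology X W)"
      using S[OF V(1)] V(2) by (intro second_countable_subtopology_countable) (auto simp: good_def)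
    then have "metrizable_space (subtopology X W)"
      using X by (intro completely_regular_second_countable_imp_metrizable_space)
        (auto simp: completely_regular_space_subtopology Hausdorff_space_subtopology)
    moreover have "D \<inter> W = W" using V by (auto simp: D_def)
    ultimately show "metrizable_space (subtopology (subtopology X D) W)"
      by (simp add: subtopology_subtopology)
  qed
  ultimately show ?thesis using D by blast
qed

section \<open>Nested closed sets in compact spaces, and shrinking in regular spaces\<close>

lemma compact_space_decreasing_nonempty:
  fixes C :: "nat \<Rightarrow> 'a set"
  assumes "compact_space X" "\<And>n. closedin X (C n)" "\<And>n. C n \<noteq> {}" "\<And>n. C (Suc n) \<subseteq> C n"
  shows "(\<Inter>n. C n) \<noteq> {}"
proof (rule compact_space_imp_nest)
  show "decseq C" using assms(4) by (rule decseq_SucI)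
qed (use assms in auto)

text \<open>The closed sets \<open>C n - U\<close> decrease to the empty set, so by compactness one
  of them is empty.\<close>

lemma compact_space_decreasing_subset_open:
  fixes C :: "nat \<Rightarrow> 'a set"
  assumes "compact_space X" "\<And>n. closedin X (C n)" "\<And>n. C (Suc n) \<subseteq> C n"
    and "openin X U" "(\<Inter>n. C n) \<subseteq> U"
  shows "\<exists>n. C n \<subseteq> U"
proof (rule ccontr)
  assume "\<not> ?thesis"
  then have "(\<Inter>n. C n - U) \<noteq> {}"
    using assms by (intro compact_space_decreasing_nonempty[of X]) (auto intro: closedin_diff)
  then show False using assms(5) by blast
qed

lemma regular_space_shrink:
  assumes "regular_space X" "openin X U" "x \<in> U"
  shows "\<exists>V. openin X V \<and> x \<in> V \<and> X closure_of V \<subseteq> U"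
proof -
  have "neighbourhood_base_of (closedin X) X"
    using assms(1) by (simp add: neighbourhood_base_of_closedin)
  then obtain V C where "openin X V" "closedin X C" "x \<in> V" "V \<subseteq> C" "C \<subseteq> U"
    using assms(2,3) unfolding neighbourhood_base_of by meson
  then show ?thesis using closure_of_minimal[of V C X] by (meson order_trans)
qed

section \<open>Upper semicontinuous maps with finite values\<close>

text \<open>The closed-set form of upper semicontinuity, obtained by passing to complements.\<close>

lemma usc_map_closedin_preimage:
  assumes "usc_map M X p" "closedin X C"
  shows "closedin M {m \<in> topspace M. p m \<inter> C \<noteq> {}}"
proof -
  have "openin M {m \<in> topspace M. p m \<subseteq> topspace X - C}"
    using assms by (simp add: usc_map_def openin_diff)
  moreover have "topspace M - {m \<in> topspace M. p m \<inter> C \<noteq> {}} = {m \<in> topspace M. p m \<subseteq> topspace X - C}"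
    using assms(1) unfolding usc_map_def multivalued_map_def by blast
  ultimately show ?thesis by (simp add: closedin_def)
qed

text \<open>Given an open cover, the sets \<open>O' F\<close> for finite subfamilies
  \<open>F\<close> are open by upper semicontinuity, and they cover \<open>E\<close> because each
  value is compact. Finitely many of them cover \<open>E\<close>, and the union of the corresponding
  \<open>F\<close> is a finite subcover.\<close>

lemma usc_map_compactin_image:
  assumes p: "usc_map M X p" and E: "compactin M E" and fin: "\<And>m. m \<in> E \<Longrightarrow> compactin X (p m)"
  shows "compactin X (\<Union>m\<in>E. p m)"
  unfolding compactin_def
proof (intro conjI allI impI)
  show "(\<Union>m\<in>E. p m) \<subseteq> topspace X"
    using fin compactin_subset_topspace by blast
  fix \<U> assume \<U>: "(\<forall>U\<in>\<U>. openin X U) \<and> (\<Union>m\<in>E. p m) \<subseteq> \<Union>\<U>"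
  define O' where "O' F = {m \<in> topspace M. p m \<subseteq> \<Union>F}" for F
  have "openin M W" if "W \<in> O' ` {F. finite F \<and> F \<subseteq> \<U>}" for W
  proof -
    from that obtain F where F: "F \<subseteq> \<U>" "W = O' F" by auto
    then have "openin X (\<Union>F)" using \<U> by blast
    then show ?thesis using p F by (simp add: O'_def usc_map_def)
  qed
  moreover have "E \<subseteq> \<Union>(O' ` {F. finite F \<and> F \<subseteq> \<U>})"
  proof
    fix m assume m: "m \<in> E"
    then have "p m \<subseteq> \<Union>\<U>" using \<U> by blast
    then obtain F where "finite F" "F \<subseteq> \<U>" "p m \<subseteq> \<Union>F"
      using compactinD[OF fin[OF m], of \<U>] \<U> by blast
    moreover have "m \<in> topspace M" using E m compactin_subset_topspace by blast
    ultimately show "m \<in> \<Union>(O' ` {F. finite F \<and> F \<subseteq> \<U>})" by (auto simp: O'_def)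
  qed
  ultimately obtain \<F> where \<F>: "finite \<F>" "\<F> \<subseteq> O' ` {F. finite F \<and> F \<subseteq> \<U>}" "E \<subseteq> \<Union>\<F>"
    using compactinD[OF E, of "O' ` {F. finite F \<and> F \<subseteq> \<U>}"] by auto
  from finite_subset_image[OF \<F>(1,2)]
  obtain \<G> where \<G>: "finite \<G>" "\<G> \<subseteq> {F. finite F \<and> F \<subseteq> \<U>}" "E \<subseteq> \<Union>(O' ` \<G>)"
    using \<F>(3) by auto
  then have "finite (\<Union>\<G>)" "\<Union>\<G> \<subseteq> \<U>" by auto
  moreover have "(\<Union>m\<in>E. p m) \<subseteq> \<Union>(\<Union>\<G>)"
  proof (rule UN_least)
    fix m assume "m \<in> E"
    then obtain F where "F \<in> \<G>" "m \<in> O' F" using \<G>(3) by blast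
    then have "p m \<subseteq> \<Union>F" "\<Union>F \<subseteq> \<Union>(\<Union>\<G>)" by (simp_all add: O'_def) blast
    then show "p m \<subseteq> \<Union>(\<Union>\<G>)" by simp
  qed
  ultimately show "\<exists>\<F>. finite \<F> \<and> \<F> \<subseteq> \<U> \<and> (\<Union>m\<in>E. p m) \<subseteq> \<Union>\<F>" by blast
qed

section \<open>Compactness, countable character and separability for a fixed finite-valued map
  \<open>p\<close>\<close>

locale finite_usc_image =
  fixes M :: "'b topology" and X :: "'a topology" and p :: "'b \<Rightarrow> 'a set"
  assumes X: "completely_regular_space X" "Hausdorff_space X"
    and M: "Hausdorff_space M" "compact_space M" "second_countable M"
    and usc: "usc_map M X p"
    and onto: "(\<Union>m \<in> topspace M. p m) = topspace X"
    and fin: "\<And>m. m \<in> topspace M \<Longrightarrow> finite (p m)"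
begin

lemma values_subset: "m \<in> topspace M \<Longrightarrow> p m \<subseteq> topspace X"
  using onto by blast

lemma regular: "regular_space X"
  using X completely_regular_imp_regular_space by blast

lemma compactin_image:
  assumes "closedin M E"
  shows "compactin X (\<Union>m\<in>E. p m)"
proof (rule usc_map_compactin_image[OF usc])
  show "compactin M E" using assms M(2) by (rule closedin_compact_space[rotated])
  show "compactin X (p m)" if "m \<in> E" for m
    using that closedin_subset[OF assms] values_subset fin by (intro finite_imp_compactin) auto
qed

lemma compact: "compact_space X"
  using compactin_image[of "topspace M"] onto by (simp add: compact_space_def)

lemma closedin_image: "closedin M E \<Longrightarrow> closedin X (\<Union>m\<in>E. p m)"
  using compactin_image X(2) compactin_imp_closedin by blast

text \<open>Open sets in \<open>X\<close> and closed sets in \<open>M\<close> are shrunk together.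
  Step \<open>n\<close> decides on which side of the basic set \<open>B n\<close> the closed set
  lies, so the closed sets end in at most one point \<open>m\<close>, and the intersection of the
  open sets is contained in \<open>p m\<close>.\<close>

lemma ex_finite_G_delta:
  assumes "openin X U" "U \<noteq> {}"
  shows "\<exists>V::nat \<Rightarrow> 'a set. V 0 \<subseteq> U \<and> (\<forall>n. openin X (V n) \<and> V n \<noteq> {} \<and> X closure_of V (Suc n) \<subseteq> V n) \<and>
              finite (\<Inter>n. V n)"
proof -
  obtain \<B> where \<B>: "countable \<B>" "\<And>V. V \<in> \<B> \<Longrightarrow> openin M V"
      "\<And>U x. openin M U \<Longrightarrow> x \<in> U \<Longrightarrow> \<exists>V \<in> \<B>. x \<in> V \<and> V \<subseteq> U"
    using M(3) unfolding second_countable_def by metis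
  \<comment> \<open>Inserting the empty set makes the family nonempty, so that
    \<open>from_nat_into\<close> enumerates exactly this family even when the base is empty.\<close>
  define B where "B = from_nat_into (insert {} \<B>)"
  have B: "range B = insert {} \<B>"
    using \<B>(1) by (simp add: B_def)
  have Bop: "openin M (B n)" for n
    using B \<B>(2) rangeI[of B n] by auto
  define P where "P EV \<longleftrightarrow> closedin M (fst EV) \<and> openin X (snd EV) \<and> snd EV \<noteq> {} \<and>
      snd EV \<subseteq> U \<and> snd EV \<subseteq> (\<Union>m\<in>fst EV. p m)" for EV
  define Q where "Q n EV EV' \<longleftrightarrow> fst EV' \<subseteq> fst EV \<and> X closure_of snd EV' \<subseteq> snd EV \<and>
      (fst EV' \<subseteq> M closure_of B n \<or> fst EV' \<inter> B n = {})" for n :: nat and EV EV' :: "'b set \<times> 'a set"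
  have "P (topspace M, U)"
    using assms onto openin_subset[OF assms(1)] by (simp add: P_def)
  moreover have "\<exists>EV'. P EV' \<and> Q n EV EV'" if P: "P EV" for EV n
  proof -
    obtain E V where EV: "EV = (E, V)" by (cases EV)
    have E: "closedin M E" and V: "openin X V" "V \<noteq> {}" "V \<subseteq> U" "V \<subseteq> (\<Union>m\<in>E. p m)"
      using P EV by (auto simp: P_def)
    let ?E1 = "E \<inter> M closure_of B n" and ?E2 = "E - B n"
    have cl: "closedin M ?E1" "closedin M ?E2"
      using E Bop by (auto intro: closedin_diff)
    have E12: "E \<subseteq> ?E1 \<union> ?E2"
      using closure_of_subset[OF openin_subset[OF Bop]] by blast
    \<comment> \<open>Two closed sets cover \<open>V\<close>, so one of them contains a nonempty open subset of it.\<close>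
    have "\<exists>E' W. E' \<in> {?E1, ?E2} \<and> openin X W \<and> W \<noteq> {} \<and> W \<subseteq> V \<and> W \<subseteq> (\<Union>m\<in>E'. p m)"
    proof (cases "V \<subseteq> (\<Union>m\<in>?E1. p m)")
      case True
      then show ?thesis using V by blast
    next
      case False
      have "openin X (V - (\<Union>m\<in>?E1. p m))"
        using V(1) closedin_image[OF cl(1)] by (rule openin_diff)
      moreover have "V - (\<Union>m\<in>?E1. p m) \<subseteq> (\<Union>m\<in>?E2. p m)"
        using V(4) E12 by blast
      ultimately show ?thesis using False by blast
    qed
    then obtain E' W where W: "E' \<in> {?E1, ?E2}" "openin X W" "W \<noteq> {}" "W \<subseteq> V" "W \<subseteq> (\<Union>m\<in>E'. p m)"
      by blast
    then obtain x where "x \<in> W" by blast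
    then obtain W' where W': "openin X W'" "x \<in> W'" "X closure_of W' \<subseteq> W"
      using regular_space_shrink[OF regular W(2)] by blast
    have "W' \<subseteq> W"
      using W'(3) closure_of_subset[OF openin_subset[OF W'(1)]] by blast
    then have "P (E', W')" "Q n EV (E', W')"
      using W W' cl V(3) EV by (auto simp: P_def Q_def)
    then show ?thesis by blast
  qed
  ultimately obtain EV where EV: "\<And>n. P (EV n)" "\<And>n. Q n (EV n) (EV (Suc n))"
    using dependent_nat_choice[of "\<lambda>_. P" Q] by metis
  define E V where "E n = fst (EV n)" and "V n = snd (EV n)" for n
  have E: "closedin M (E n)" "E (Suc n) \<subseteq> E n" "E (Suc n) \<subseteq> M closure_of B n \<or> E (Suc n) \<inter> B n = {}"
    and V: "openin X (V n)" "V n \<noteq> {}" "V n \<subseteq> U" "X closure_of V (Suc n) \<subseteq> V n" "V n \<subseteq> (\<Union>m\<in>E n. p m)" for n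
    using EV(1)[of n] EV(2)[of n] by (auto simp: P_def Q_def E_def V_def)
  \<comment> \<open>Some basic set \<open>B n\<close> contains \<open>a\<close> and has a closure
    that misses \<open>b\<close>. As \<open>E (Suc n)\<close> contains \<open>a\<close>, it must lie
    in that closure, which excludes \<open>b\<close>.\<close>
  have single: "a = b" if ab: "a \<in> (\<Inter>n. E n)" "b \<in> (\<Inter>n. E n)" for a b
  proof (rule ccontr)
    assume "a \<noteq> b"
    moreover have "a \<in> topspace M" "b \<in> topspace M"
      using ab closedin_subset[OF E(1)] by blast+
    ultimately obtain S T where ST: "openin M S" "openin M T" "a \<in> S" "b \<in> T" "disjnt S T"
      using M(1) unfolding Hausdorff_space_def by blast
    then obtain C where C: "C \<in> \<B>" "a \<in> C" "C \<subseteq> S" using \<B>(3) by blast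
    then obtain n where n: "B n = C" using B by (metis insertCI rangeE)
    have "b \<notin> M closure_of C"
      using ST C(3) unfolding in_closure_of disjnt_def by blast
    then show False using E(3)[of n] ab C(2) n by blast
  qed
  have "finite (\<Inter>n. V n)"
  proof (cases "(\<Inter>n. V n) = {}")
    case False
    \<comment> \<open>The closed set of all \<open>m\<close> with \<open>x \<in> p m\<close> meets
      every \<open>E n\<close>, hence by compactness of \<open>M\<close> it meets their
      intersection.\<close>
    have mem: "\<exists>m\<in>(\<Inter>n. E n). x \<in> p m" if x: "x \<in> (\<Inter>n. V n)" for x
    proof -
      have "x \<in> topspace X" using x openin_subset[OF V(1)] by blast
      then have "closedin M {m \<in> topspace M. p m \<inter> {x} \<noteq> {}}"
        by (intro usc_map_closedin_preimage[OF usc] closedin_Hausdorff_singleton X(2))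
      then have "(\<Inter>n. E n \<inter> {m \<in> topspace M. p m \<inter> {x} \<noteq> {}}) \<noteq> {}"
      proof (intro compact_space_decreasing_nonempty[OF M(2)])
        fix n
        obtain m where "m \<in> E n" "x \<in> p m" using x V(5) by blast
        then show "E n \<inter> {m \<in> topspace M. p m \<inter> {x} \<noteq> {}} \<noteq> {}"
          using closedin_subset[OF E(1)] by blast
      qed (use E(1,2) in blast)+
      then show ?thesis by blast
    qed
    from False obtain x where "x \<in> (\<Inter>n. V n)" by auto
    from mem[OF this] obtain m where m: "m \<in> (\<Inter>n. E n)" ..
    have "(\<Inter>n. V n) \<subseteq> p m"
    proof
      fix x assume "x \<in> (\<Inter>n. V n)"
      from mem[OF this] obtain m' where "m' \<in> (\<Inter>n. E n)" "x \<in> p m'" ..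
      then show "x \<in> p m" using single[OF m] by metis
    qed
    moreover have "m \<in> E 0" using m by simp
    then have "m \<in> topspace M" using closedin_subset[OF E(1)] by blast
    ultimately show ?thesis using fin finite_subset by metis
  qed simp
  then show ?thesis using V by blast
qed

text \<open>The finite intersection of the preceding lemma is nonempty by compactness of
  \<open>X\<close>. Cutting with a neighbourhood \<open>W\<close> of one of its points
  \<open>x\<close> removes the others, and then the sets \<open>V n \<inter> W\<close> form a local
  base at \<open>x\<close>.\<close>

lemma ex_countable_base_at:
  assumes "openin X U" "U \<noteq> {}"
  shows "\<exists>x\<in>U. countable_base_at X x"
proof -
  obtain V :: "nat \<Rightarrow> 'a set" where V: "V 0 \<subseteq> U" "\<And>n. openin X (V n)" "\<And>n. V n \<noteq> {}"
      "\<And>n. X closure_of V (Suc n) \<subseteq> V n" and H: "finite (\<Inter>n. V n)"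
    using ex_finite_G_delta[OF assms] by blast
  have sub: "V n \<subseteq> X closure_of V n" for n
    using closure_of_subset[OF openin_subset[OF V(2)]] .
  have "(\<Inter>n. X closure_of V n) \<noteq> {}"
  proof (rule compact_space_decreasing_nonempty[OF compact])
    show "X closure_of V n \<noteq> {}" for n
      using sub V(3) by blast
    show "X closure_of V (Suc n) \<subseteq> X closure_of V n" for n
      using V(4) sub by blast
  qed simp
  then obtain x where x: "x \<in> (\<Inter>n. V n)" using V(4) by blast
  have topX: "x \<in> topspace X" using x openin_subset[OF V(2)] by blast
  have "closedin X ((\<Inter>n. V n) - {x})"
    using H openin_subset[OF V(2)] by (intro closedin_Hausdorff_finite[OF X(2)]) auto
  then have "openin X (topspace X - ((\<Inter>n. V n) - {x}))" by blast
  then obtain W where W: "openin X W" "x \<in> W" "X closure_of W \<subseteq> topspace X - ((\<Inter>n. V n) - {x})"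
    using regular_space_shrink[OF regular _, of _ x] topX by (metis DiffI DiffD2 insertI1)
  have "\<exists>n. V n \<inter> W \<subseteq> T" if T: "openin X T" "x \<in> T" for T
  proof -
    \<comment> \<open>Compactness needs closed sets. Passing to closures costs one index, since the
      closure of \<open>V (Suc n)\<close> lies in \<open>V n\<close>, so the closures still
      intersect in at most \<open>x\<close>.\<close>
    have "\<exists>n. X closure_of (V n \<inter> W) \<subseteq> T"
    proof (rule compact_space_decreasing_subset_open[OF compact _ _ T(1)])
      show "X closure_of (V (Suc n) \<inter> W) \<subseteq> X closure_of (V n \<inter> W)" for n
        using V(4)[of n] sub[of "Suc n"] by (intro closure_of_mono) blast
      have "X closure_of (V (Suc n) \<inter> W) \<subseteq> V n \<inter> X closure_of W" for n
        using V(4)[of n] closure_of_mono[of "V (Suc n) \<inter> W" _ X] by (meson Int_greatest inf_le1 inf_le2 order_trans)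
      then have "(\<Inter>n. X closure_of (V n \<inter> W)) \<subseteq> (\<Inter>n. V n) \<inter> X closure_of W" by blast
      then show "(\<Inter>n. X closure_of (V n \<inter> W)) \<subseteq> T" using W(3) T(2) by blast
    qed simp
    moreover have "V n \<inter> W \<subseteq> X closure_of (V n \<inter> W)" for n
      using closure_of_subset[OF openin_subset[OF openin_Int[OF V(2) W(1)]]] .
    ultimately show ?thesis by blast
  qed
  moreover have "openin X (V n \<inter> W)" "x \<in> V n \<inter> W" for n
    using V(2) W(1,2) x by auto
  ultimately have "countable_base_at X x"
    unfolding countable_base_at_def
    by (intro exI[of _ "range (\<lambda>n. V n \<inter> W)"]) auto
  then show ?thesis using x V(1) by blast
qed

text \<open>Second countability of \<open>M\<close> is pulled back along an arbitrary function
  \<phi>: one point of \<open>T\<close> is chosen over each basic set that meets the image of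
  \<open>T\<close>.\<close>

lemma ex_countable_image_dense_subset:
  shows "\<exists>S. countable S \<and> S \<subseteq> T \<and> M closure_of (\<phi> ` T) \<subseteq> M closure_of (\<phi> ` S)"
proof -
  obtain \<B> where \<B>: "countable \<B>" "\<And>V. V \<in> \<B> \<Longrightarrow> openin M V"
      "\<And>U x. openin M U \<Longrightarrow> x \<in> U \<Longrightarrow> \<exists>V \<in> \<B>. x \<in> V \<and> V \<subseteq> U"
    using M(3) unfolding second_countable_def by metis
  have "\<exists>s. s \<in> T \<and> \<phi> s \<in> V" if "V \<inter> \<phi> ` T \<noteq> {}" for V
    using that by blast
  then obtain s where s: "\<And>V. V \<inter> \<phi> ` T \<noteq> {} \<Longrightarrow> s V \<in> T \<and> \<phi> (s V) \<in> V"
    by metis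
  let ?S = "s ` {V \<in> \<B>. V \<inter> \<phi> ` T \<noteq> {}}"
  have "m \<in> M closure_of (\<phi> ` ?S)" if m: "m \<in> M closure_of (\<phi> ` T)" for m
    unfolding in_closure_of
  proof (intro conjI allI impI)
    show "m \<in> topspace M" using m by (simp add: in_closure_of)
    fix W assume W: "m \<in> W \<and> openin M W"
    obtain V where V: "V \<in> \<B>" "m \<in> V" "V \<subseteq> W" using \<B>(3) W by blast
    have "V \<inter> \<phi> ` T \<noteq> {}" using m V(2) \<B>(2)[OF V(1)] unfolding in_closure_of by blast
    then show "\<exists>y. y \<in> \<phi> ` ?S \<and> y \<in> W"
      using s V by (intro exI[of _ "\<phi> (s V)"]) blast
  qed
  then show ?thesis
    using \<B>(1) s by (intro exI[of _ ?S]) auto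
qed

lemma ex_separable_open_subset:
  assumes U: "openin X U" "U \<noteq> {}"
  shows "\<exists>V S. openin X V \<and> V \<noteq> {} \<and> V \<subseteq> U \<and> countable S \<and> S \<subseteq> V \<and>
               (\<forall>x\<in>S. countable_base_at X x) \<and> V \<subseteq> X closure_of S"
proof (rule ccontr)
  assume none: "\<not> ?thesis"
  define G where "G = {x. countable_base_at X x}"
  have "\<exists>m. m \<in> topspace M \<and> x \<in> p m" if "x \<in> topspace X" for x
    using that onto by blast
  \<comment> \<open>\<phi> selects, with no continuity, a parameter whose value contains
    \<open>x\<close>; it transfers density questions from \<open>X\<close> to
    \<open>M\<close>.\<close>
  then obtain \<phi> where \<phi>: "\<And>x. x \<in> topspace X \<Longrightarrow> \<phi> x \<in> topspace M \<and> x \<in> p (\<phi> x)"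
    by metis
  obtain S where S: "\<And>T. countable (S T) \<and> S T \<subseteq> T \<and> M closure_of (\<phi> ` T) \<subseteq> M closure_of (\<phi> ` S T)"
    using ex_countable_image_dense_subset[of _ \<phi>] by metis
  \<comment> \<open>\<open>s V\<close> is a countable set of points of countable character in
    \<open>V\<close> whose image under \<phi> is dense in the image of all such points of
    \<open>V\<close>.\<close>
  define s where "s V = S (V \<inter> G)" for V
  define P where "P V \<longleftrightarrow> openin X V \<and> V \<noteq> {} \<and> V \<subseteq> U" for V
  define Q where "Q V W \<longleftrightarrow> X closure_of W \<subseteq> V - X closure_of (s V)" for V W
  have "\<exists>W. P W \<and> Q V W" if P: "P V" for V
  proof -
    have V: "openin X V" "V \<noteq> {}" "V \<subseteq> U" using P by (auto simp: P_def)
    have "countable (s V)" "s V \<subseteq> V \<inter> G" using S by (auto simp: s_def)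
    \<comment> \<open>Otherwise \<open>V\<close> and \<open>s V\<close> would be the pair excluded
      by \<open>none\<close>.\<close>
    then have "\<not> V \<subseteq> X closure_of (s V)"
      using none V unfolding G_def by blast
    then obtain x where "x \<in> V - X closure_of (s V)" by blast
    moreover have "openin X (V - X closure_of (s V))"
      using V(1) by (simp add: openin_diff)
    ultimately obtain W where W: "openin X W" "x \<in> W" "X closure_of W \<subseteq> V - X closure_of (s V)"
      using regular_space_shrink[OF regular] by blast
    moreover have "W \<subseteq> X closure_of W"
      using closure_of_subset[OF openin_subset[OF W(1)]] .
    ultimately have "P W" "Q V W"
      using V(3) by (auto simp: P_def Q_def)
    then show ?thesis by blast
  qed
  moreover have "P U" using U by (simp add: P_def)
  ultimately obtain V where V: "\<And>n. P (V n)" "\<And>n. Q (V n) (V (Suc n))"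
    using dependent_nat_choice[of "\<lambda>_. P" "\<lambda>_. Q"] by metis
  have Vop: "openin X (V n)" and Vne: "V n \<noteq> {}" for n
    using V(1)[of n] by (auto simp: P_def)
  have Vsub: "V n \<subseteq> X closure_of V n" for n
    using closure_of_subset[OF openin_subset[OF Vop]] .
  have Vdec: "X closure_of V (Suc n) \<subseteq> X closure_of V n" for n
    using V(2)[of n] Vsub[of n] by (auto simp: Q_def)
  \<comment> \<open>The sets \<open>s (V n)\<close> need not decrease, so compactness is applied to
    the images of the full sets \<open>V n \<inter> G\<close>. By the choice of \<open>s\<close>,
    the resulting \<open>m\<close> also lies in the closure of the image of each
    \<open>s (V n)\<close>.\<close>
  have "(\<Inter>n. M closure_of (\<phi> ` (V n \<inter> G))) \<noteq> {}"
  proof (rule compact_space_decreasing_nonempty[OF M(2)])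
    fix n
    obtain x where x: "x \<in> V n \<inter> G"
      using ex_countable_base_at[OF Vop Vne] by (auto simp: G_def)
    have "\<phi> ` (V n \<inter> G) \<subseteq> topspace M"
      using \<phi> openin_subset[OF Vop] by blast
    then show "M closure_of (\<phi> ` (V n \<inter> G)) \<noteq> {}"
      using x closure_of_subset by blast
    have "V (Suc n) \<subseteq> V n"
      using V(2)[of n] Vsub[of "Suc n"] by (auto simp: Q_def)
    then show "M closure_of (\<phi> ` (V (Suc n) \<inter> G)) \<subseteq> M closure_of (\<phi> ` (V n \<inter> G))"
      by (intro closure_of_mono) blast
  qed simp
  then obtain m where m: "\<And>n. m \<in> M closure_of (\<phi> ` (V n \<inter> G))" by blast
  have "\<exists>y. y \<in> p m \<and> y \<in> X closure_of s (V n)" for n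
  proof -
    \<comment> \<open>Upper semicontinuity makes this set closed, and it contains the image of
      \<open>s (V n)\<close> under \<phi>. Hence it contains \<open>m\<close>, so \<open>p m\<close>
      meets the closure of \<open>s (V n)\<close>.\<close>
    let ?C = "{m \<in> topspace M. p m \<inter> X closure_of s (V n) \<noteq> {}}"
    have "s (V n) \<subseteq> topspace X"
      using S openin_subset[OF Vop] unfolding s_def by blast
    then have "\<phi> ` s (V n) \<subseteq> ?C"
      using \<phi> closure_of_subset by blast
    then have "M closure_of (\<phi> ` s (V n)) \<subseteq> ?C"
      by (intro closure_of_minimal usc_map_closedin_preimage[OF usc]) auto
    then show ?thesis using m[of n] S unfolding s_def by blast
  qed
  then obtain y where y: "\<And>n. y n \<in> p m" "\<And>n. y n \<in> X closure_of s (V n)" by metis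
  \<comment> \<open>For \<open>i < j\<close>, the point \<open>y j\<close> lies in the closure of
    \<open>V (Suc i)\<close>, which \<open>Q\<close> keeps away from the closure of
    \<open>s (V i)\<close>, where \<open>y i\<close> lies.\<close>
  have ne: "y i \<noteq> y j" if "i < j" for i j
  proof -
    have "s (V j) \<subseteq> V j" using S unfolding s_def by blast
    then have "y j \<in> X closure_of V j" using y(2) closure_of_mono by blast
    also have "\<dots> \<subseteq> X closure_of V (Suc i)"
      using lift_Suc_antimono_le[of "\<lambda>n. X closure_of V n"] Vdec that by simp
    finally show ?thesis using V(2)[of i] y(2)[of i] by (auto simp: Q_def)
  qed
  have "inj y"
    using ne by (metis injI linorder_neqE_nat)
  then have "infinite (range y)" by (rule range_inj_infinite)
  moreover have "m \<in> topspace M" using m[of 0] by (simp add: in_closure_of)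
  ultimately show False using fin y(1) finite_subset[of "range y" "p m"] by blast
qed

end

theorem corollary5p7:
  fixes X :: "'a topology"
  assumes "KL_Sigma_fin TYPE('b) X"
  shows "\<exists>D. D \<subseteq> topspace X \<and> X closure_of D = topspace X \<and>
             metrizable_space (subtopology X D)"
proof -
  obtain M :: "'b topology" and p where "finite_usc_image M X p"
    using assms unfolding KL_Sigma_fin_def tychonoff_space_def finite_usc_image_def by blast
  then interpret finite_usc_image M X p .
  show ?thesis
    using X ex_separable_open_subset by (rule dense_metrizable_subspace)
qed

end
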